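(* Let $H:[0,+\infty[\to\mathbb{R}$ be a Lebesgue integrable function such that $t\mapsto\frac{H(t)-H(0)}{t}$ is bounded on $]0,\epsilon[$ for some $\epsilon>0$. Assume $H\geq 0$ and that $H$ is nonzero in $\mathrm{L}^1(]0,+\infty[)$. Then for all integers $n\geq 0$, the quadratic form $\mathrm{q}_n^H$ is negative definite on the subspace of $\mathbb{R}^{n+1}$ defined by $H(0)\sum_{i=0}^n x_i=0$.
   Context: For $s\in\mathbb{C}$ with $\mathrm{Re}\,s\ge0$, set $\psi_H(s)=\int_0^\infty\left(H(0)\frac{e^{-t}}{t}-H(t)\frac{e^{-st}}{1-e^{-t}}\right)\mathrm{d}t$, which is absolutely convergent. For an integer $n\ge0$, $\mathrm{q}_n^H:\mathbb{R}^{n+1}\to\mathbb{R}$ is the quadratic form $\mathrm{q}_n^H(x_0,\dots,x_n)=\sum_{0\le i,j\le n}x_ix_j\,\psi_H(|i-j|)$. *)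

theory Defs
  imports "HOL-Analysis.Analysis"
begin

text \<open>
  A function on \<open>[0,\<infinity>[\<close> is a total function \<open>H :: real \<Rightarrow> real\<close> whose values at negative
  arguments are never used. The Bochner integral below is meant for \<open>Re s \<ge> 0\<close>; it is 0 by
  convention when the integrand is not integrable.
\<close>

definition psi :: "(real \<Rightarrow> real) \<Rightarrow> complex \<Rightarrow> complex" where
  "psi H s = (LINT t:{0<..}|lebesgue.
     complex_of_real (H 0) * (complex_of_real (exp (- t)) / complex_of_real t)
     - complex_of_real (H t) * (exp (- s * complex_of_real t) / (1 - complex_of_real (exp (- t)))))"

text \<open>At real arguments \<^const>\<open>psi\<close> is real, so the real part taken in \<open>q_form\<close> loses nothing.\<close>

lemma psi_of_real:
  "psi H (complex_of_real r) = complex_of_real (LINT t:{0<..}|lebesgue.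
     H 0 * (exp (- t) / t) - H t * (exp (- r * t) / (1 - exp (- t))))"
  unfolding psi_def set_integral_complex_of_real[symmetric]
  by (simp flip: exp_of_real)

text \<open>Vectors of \<open>\<real>\<close>\<open>\<^sup>n\<^sup>+\<^sup>1\<close> are functions on \<^typ>\<open>nat\<close> of which only the entries \<open>0, \<dots>, n\<close> count.\<close>

definition q_form :: "(real \<Rightarrow> real) \<Rightarrow> nat \<Rightarrow> (nat \<Rightarrow> real) \<Rightarrow> real" where
  "q_form H n x = (\<Sum>i\<le>n. \<Sum>j\<le>n. x i * x j * Re (psi H (of_int \<bar>int i - int j\<bar>)))"

definition negative_definite_on :: "nat \<Rightarrow> (nat \<Rightarrow> real) set \<Rightarrow> ((nat \<Rightarrow> real) \<Rightarrow> real) \<Rightarrow> bool" where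
  "negative_definite_on n V q \<longleftrightarrow> (\<forall>x\<in>V. (\<exists>i\<le>n. x i \<noteq> 0) \<longrightarrow> q x < 0)"

end

theory Submission
  imports Defs
begin

text \<open>
  On the hyperplane \<open>H 0 * (\<Sum>i\<le>n. x i) = 0\<close> the singular terms \<open>H 0 * exp (- t) / t\<close> cancel, so
  that \<open>q_form H n x\<close> is minus the integral over \<open>t > 0\<close> of \<open>H t / (1 - exp (- t))\<close> times
  the quadratic form with matrix \<open>r ^ \<bar>i - j\<bar>\<close>, where \<open>r = exp (- t)\<close>. The latter form is
  positive definite for \<open>0 < r < 1\<close>: in the variables \<open>y k = (\<Sum>i\<le>k. r ^ (k - i) * x i)\<close> it is
  the sum of squares \<open>(y n)\<^sup>2 + (1 - r\<^sup>2) * (\<Sum>k<n. (y k)\<^sup>2)\<close>.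
\<close>

lemma power_absdiff_form_eq_sum_squares:
  fixes x :: "nat \<Rightarrow> real" and r :: real
  defines "y \<equiv> \<lambda>k. \<Sum>i\<le>k. r ^ (k - i) * x i"
  shows "(\<Sum>i\<le>n. \<Sum>j\<le>n. x i * x j * r ^ nat \<bar>int i - int j\<bar>) =
    (y n)\<^sup>2 + (1 - r\<^sup>2) * (\<Sum>k<n. (y k)\<^sup>2)"
proof (induction n)
  case 0
  show ?case by (simp add: y_def power2_eq_square)
next
  case (Suc n)
  have y_Suc: "y (Suc n) = r * y n + x (Suc n)"
    by (simp add: y_def sum_distrib_left Suc_diff_le mult.assoc)
  have cross: "(\<Sum>i\<le>n. x i * x (Suc n) * r ^ nat \<bar>int i - int (Suc n)\<bar>) = x (Suc n) * (r * y n)"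
    unfolding y_def sum_distrib_left
  proof (intro sum.cong refl)
    fix i assume "i \<in> {..n}"
    then have "nat \<bar>int i - int (Suc n)\<bar> = Suc (n - i)" by auto
    then show "x i * x (Suc n) * r ^ nat \<bar>int i - int (Suc n)\<bar> = x (Suc n) * (r * (r ^ (n - i) * x i))"
      by (simp only: power_Suc) simp
  qed
  have "(\<Sum>j\<le>n. x (Suc n) * x j * r ^ nat \<bar>int (Suc n) - int j\<bar>) = x (Suc n) * (r * y n)"
    unfolding cross[symmetric] by (simp add: abs_minus_commute mult.commute mult.left_commute)
  \<comment> \<open>The new row and column add
    \<open>2 * x (Suc n) * (r * y n) + (x (Suc n))\<^sup>2\<close>. By \<open>y_Suc\<close> this is
    \<open>(y (Suc n))\<^sup>2 - r\<^sup>2 * (y n)\<^sup>2\<close>, so the old leading square keeps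
    the weight \<open>1 - r\<^sup>2\<close> and joins the sum.\<close>
  with cross have "(\<Sum>i\<le>Suc n. \<Sum>j\<le>Suc n. x i * x j * r ^ nat \<bar>int i - int j\<bar>) =
      (\<Sum>i\<le>n. \<Sum>j\<le>n. x i * x j * r ^ nat \<bar>int i - int j\<bar>)
      + 2 * (x (Suc n) * (r * y n)) + (x (Suc n))\<^sup>2"
    by (simp add: sum.distrib power2_eq_square del: of_nat_Suc)
  then show ?case
    unfolding Suc.IH y_Suc by (simp add: power2_eq_square algebra_simps)
qed

lemma power_absdiff_form_pos:
  fixes x :: "nat \<Rightarrow> real" and r :: real
  assumes r: "0 < r" "r < 1" and nz: "\<exists>i\<le>n. x i \<noteq> 0"
  shows "(\<Sum>i\<le>n. \<Sum>j\<le>n. x i * x j * r ^ nat \<bar>int i - int j\<bar>) > 0"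
proof -
  define y where "y = (\<lambda>k. \<Sum>i\<le>k. r ^ (k - i) * x i)"
  have r2: "r\<^sup>2 < 1" using r by (simp add: power_less_one_iff)
  \<comment> \<open>At the first nonzero entry \<open>m\<close> all earlier terms of
    \<open>y m\<close> vanish, so \<open>y m = x m\<close>. Its square has weight 1 if
    \<open>m = n\<close> and weight \<open>1 - r\<^sup>2\<close> otherwise, whence the case split
    below.\<close>
  obtain m where m: "m \<le> n" "x m \<noteq> 0" "\<And>i. i < m \<Longrightarrow> x i = 0"
    using exists_least_iff[of "\<lambda>i. i \<le> n \<and> x i \<noteq> 0"] nz by (metis less_imp_le order_trans)
  have "y m = (\<Sum>i\<in>{m}. r ^ (m - i) * x i)"
    unfolding y_def by (rule sum.mono_neutral_right) (use m(3) in \<open>auto simp: le_less\<close>)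
  then have ym: "(y m)\<^sup>2 > 0" using m(2) by simp
  have "(y n)\<^sup>2 + (1 - r\<^sup>2) * (\<Sum>k<n. (y k)\<^sup>2) > 0"
  proof (cases "m = n")
    case True
    with ym r2 show ?thesis by (intro add_pos_nonneg mult_nonneg_nonneg sum_nonneg) auto
  next
    case False
    with m(1) ym have "(\<Sum>k<n. (y k)\<^sup>2) > 0" by (intro sum_pos2[of _ m]) auto
    with r2 show ?thesis by (intro add_nonneg_pos mult_pos_pos) auto
  qed
  then show ?thesis unfolding y_def by (simp only: power_absdiff_form_eq_sum_squares)
qed

lemma abs_exp_minus_diff_le:
  fixes a b :: real
  assumes "a \<ge> 0" "b \<ge> 0"
  shows "\<bar>exp (- a) - exp (- b)\<bar> \<le> \<bar>a - b\<bar>"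
proof -
  have *: "exp (- u) - exp (- v) \<le> v - u" if "0 \<le> u" "u \<le> v" for u v :: real
  proof -
    have "exp (- u) - exp (- v) = exp (- u) * (1 - exp (- (v - u)))"
      by (simp add: algebra_simps flip: exp_add)
    also have "\<dots> \<le> 1 * (v - u)"
    proof (rule mult_mono)
      show "1 - exp (- (v - u)) \<le> v - u" using exp_ge_add_one_self[of "- (v - u)"] by linarith
    qed (use that in auto)
    finally show ?thesis by simp
  qed
  show ?thesis
    using *[of a b] *[of b a] assms by (cases "a \<le> b") (auto simp: abs_if)
qed

text \<open>Both terms blow up like \<open>1 / t\<close> at 0, but over the common denominator
  \<open>t * (1 - exp (- t))\<close> the numerator is of order \<open>t * t\<close>, while the
  denominator is at least \<open>t * t * exp (- t)\<close>. The growth of the bound in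
  \<open>t\<close> is harmless, since it serves only near 0.\<close>

lemma frullani_kernel_bound:
  fixes r t :: real
  assumes r: "r \<ge> 0" and t: "0 < t"
  shows "\<bar>exp (- t) / t - exp (- r * t) / (1 - exp (- t))\<bar> \<le> (1 + \<bar>1 - r\<bar>) * exp t"
proof -
  have pos: "1 - exp (- t) > 0" using t by simp
  have "t * exp (- t) \<le> 1 - exp (- t)"
    using exp_ge_add_one_self[of t] by (simp add: exp_minus field_simps)
  then have den: "t * t * exp (- t) \<le> t * (1 - exp (- t))"
    using t by (simp add: mult.assoc)
  have "exp (- t) \<le> 1 / (1 + t)"
    using exp_ge_add_one_self[of t] t by (simp add: exp_minus field_simps)
  \<comment> \<open>This rests on \<open>(1 + t) * (1 - t + t * t) = 1 + t ^ 3\<close>.\<close>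
  also have "\<dots> \<le> 1 - t + t * t"
    using t by (simp add: field_simps)
  finally have e: "\<bar>1 - exp (- t) - t\<bar> \<le> t * t"
    using exp_ge_add_one_self[of "- t"] t by (simp add: abs_le_iff)
  \<comment> \<open>Adding and subtracting \<open>t * exp (- t)\<close> splits the numerator into a
    second-order Taylor remainder and \<open>t\<close> times a difference of exponentials. The
    latter is of order \<open>t\<close> because \<open>exp (- u)\<close> is 1-Lipschitz for
    \<open>u \<ge> 0\<close>.\<close>
  have "exp (- t) * \<bar>1 - exp (- t) - t\<bar> \<le> 1 * (t * t)"
    using e t by (intro mult_mono) auto
  moreover have "\<bar>exp (- t) - exp (- r * t)\<bar> \<le> \<bar>1 - r\<bar> * t"
    using abs_exp_minus_diff_le[of t "r * t"] abs_mult_pos[of t "1 - r"] r t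
    by (simp add: left_diff_distrib)
  then have "t * \<bar>exp (- t) - exp (- r * t)\<bar> \<le> t * (\<bar>1 - r\<bar> * t)"
    using t by (intro mult_left_mono) auto
  moreover have "\<bar>exp (- t) * (1 - exp (- t) - t) + t * (exp (- t) - exp (- r * t))\<bar> \<le>
      exp (- t) * \<bar>1 - exp (- t) - t\<bar> + t * \<bar>exp (- t) - exp (- r * t)\<bar>"
    using abs_triangle_ineq[of "exp (- t) * (1 - exp (- t) - t)" "t * (exp (- t) - exp (- r * t))"] t
    by (simp add: abs_mult)
  ultimately have num: "\<bar>exp (- t) * (1 - exp (- t) - t) + t * (exp (- t) - exp (- r * t))\<bar>
      \<le> (1 + \<bar>1 - r\<bar>) * (t * t)"
    by (simp add: algebra_simps)
  have "exp (- t) / t - exp (- r * t) / (1 - exp (- t)) =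
      (exp (- t) * (1 - exp (- t) - t) + t * (exp (- t) - exp (- r * t))) / (t * (1 - exp (- t)))"
    using t pos by (simp add: divide_simps) (simp add: algebra_simps)
  then have "\<bar>exp (- t) / t - exp (- r * t) / (1 - exp (- t))\<bar> =
      \<bar>exp (- t) * (1 - exp (- t) - t) + t * (exp (- t) - exp (- r * t))\<bar> / (t * (1 - exp (- t)))"
    using t pos by (simp add: abs_divide)
  also have "\<dots> \<le> ((1 + \<bar>1 - r\<bar>) * (t * t)) / (t * t * exp (- t))"
    using num den t by (intro frac_le) auto
  also have "\<dots> = (1 + \<bar>1 - r\<bar>) * exp t"
    using t by (simp add: exp_minus field_simps)
  finally show ?thesis .
qed

text \<open>The main proof exchanges finite sums with the integral, which needs each integrand to be
  integrable. Near 0 the integrand is bounded, thanks to the bound on the difference quotient of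
  \<open>H\<close>; beyond \<epsilon> it is dominated by multiples of \<open>exp (- t)\<close> and
  \<open>\<bar>H t\<bar>\<close>.\<close>

lemma set_integrable_psi_integrand:
  fixes H :: "real \<Rightarrow> real" and r :: real
  assumes int: "set_integrable lebesgue {0..} H"
    and bdd: "\<exists>\<epsilon>>0. bounded ((\<lambda>t. (H t - H 0) / t) ` {0<..<\<epsilon>})"
    and r: "r \<ge> 0"
  shows "set_integrable lebesgue {0<..}
    (\<lambda>t. H 0 * (exp (- t) / t) - H t * (exp (- r * t) / (1 - exp (- t))))"
proof -
  let ?f = "\<lambda>t. H 0 * (exp (- t) / t) - H t * (exp (- r * t) / (1 - exp (- t)))"
  obtain \<epsilon> B where \<epsilon>: "\<epsilon> > 0" and "\<forall>y\<in>(\<lambda>t. (H t - H 0) / t) ` {0<..<\<epsilon>}. norm y \<le> B"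
    using bdd unfolding bounded_iff by blast
  then have B: "\<bar>(H t - H 0) / t\<bar> \<le> B" if "0 < t" "t < \<epsilon>" for t
    using that by auto
  have int0: "set_integrable lebesgue {0<..} H"
    by (rule set_integrable_subset[OF int]) auto
  then have "(\<lambda>t. indicator {0<..} t *\<^sub>R H t) \<in> borel_measurable lebesgue"
    by (simp add: set_integrable_def borel_measurable_integrable)
  \<comment> \<open>Measurability of \<open>H\<close> is known only after restriction to the
    half-line, so the indicator stays attached to \<open>H\<close>.\<close>
  then have "(\<lambda>t. indicator {0<..} t * (H 0 * (exp (- t) / t))
      - (indicator {0<..} t *\<^sub>R H t) * (exp (- r * t) / (1 - exp (- t)))) \<in> borel_measurable lebesgue"
    by (intro borel_measurable_diff borel_measurable_times) (auto intro!: measurable_completion)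
  then have meas: "set_borel_measurable lebesgue {0<..} ?f"
    unfolding set_borel_measurable_def by (simp add: algebra_simps)
  have near: "set_integrable lebesgue {0<..<\<epsilon>} ?f"
  proof (rule set_integrable_bound)
    show "set_integrable lebesgue {0<..<\<epsilon>}
        (\<lambda>t. \<bar>H 0\<bar> * ((1 + \<bar>1 - r\<bar>) * exp \<epsilon>) + B * exp \<epsilon>)"
      unfolding set_integrable_def using \<epsilon>
      by (intro integrable_scaleR_left integrable_real_indicator) auto
    show "set_borel_measurable lebesgue {0<..<\<epsilon>} ?f"
      by (rule set_borel_measurable_subset[OF meas]) auto
    show "AE t in lebesgue. t \<in> {0<..<\<epsilon>} \<longrightarrow> norm (?f t) \<le>
        norm (\<bar>H 0\<bar> * ((1 + \<bar>1 - r\<bar>) * exp \<epsilon>) + B * exp \<epsilon>)"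
    proof (intro AE_I2 impI)
      fix t :: real assume "t \<in> {0<..<\<epsilon>}"
      then have t: "0 < t" "t < \<epsilon>" by auto
      have pos: "1 - exp (- t) > 0" using t by simp
      have "\<bar>exp (- t) / t - exp (- r * t) / (1 - exp (- t))\<bar> \<le> (1 + \<bar>1 - r\<bar>) * exp t"
        by (rule frullani_kernel_bound) (use r t in auto)
      also have "\<dots> \<le> (1 + \<bar>1 - r\<bar>) * exp \<epsilon>"
        using t by (intro mult_left_mono) auto
      finally have 1: "\<bar>H 0 * (exp (- t) / t - exp (- r * t) / (1 - exp (- t)))\<bar>
          \<le> \<bar>H 0\<bar> * ((1 + \<bar>1 - r\<bar>) * exp \<epsilon>)"
        unfolding abs_mult by (intro mult_left_mono) auto
      have "t \<le> exp t - 1"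
        using exp_ge_add_one_self[of t] by linarith
      then have "t / (1 - exp (- t)) \<le> exp t"
        using pos by (simp add: pos_divide_le_eq right_diff_distrib flip: exp_add)
      also have "\<dots> \<le> exp \<epsilon>" using t by simp
      finally have "t / (1 - exp (- t)) \<le> exp \<epsilon>" .
      moreover have "exp (- r * t) \<le> 1" using r t by simp
      ultimately have "exp (- r * t) * (t / (1 - exp (- t))) \<le> 1 * exp \<epsilon>"
        using t pos by (intro mult_mono) auto
      moreover have "B \<ge> 0"
        using B[OF t] abs_ge_zero order_trans by blast
      ultimately have "\<bar>(H t - H 0) / t\<bar> * (exp (- r * t) * (t / (1 - exp (- t)))) \<le> B * exp \<epsilon>"
        using B[OF t] t pos by (intro mult_mono) auto
      then have 2: "\<bar>(H t - H 0) / t * (exp (- r * t) * (t / (1 - exp (- t))))\<bar> \<le> B * exp \<epsilon>"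
        using t pos by (simp add: abs_mult abs_divide)
      \<comment> \<open>Writing \<open>H t = H 0 + (H t - H 0)\<close> isolates the kernel bounded
        above; in the remainder a factor \<open>t\<close> is moved over to tame
        \<open>1 / (1 - exp (- t))\<close>.\<close>
      have "?f t = H 0 * (exp (- t) / t - exp (- r * t) / (1 - exp (- t)))
          - (H t - H 0) / t * (exp (- r * t) * (t / (1 - exp (- t))))"
        using t pos by (simp add: divide_simps) (simp add: algebra_simps)
      with 1 2 show "norm (?f t) \<le> norm (\<bar>H 0\<bar> * ((1 + \<bar>1 - r\<bar>) * exp \<epsilon>) + B * exp \<epsilon>)"
        unfolding real_norm_def by linarith
    qed
  qed
  have far: "set_integrable lebesgue {\<epsilon>..} ?f"
  proof (rule set_integrable_bound)
    have "(\<lambda>t. exp (- t)) absolutely_integrable_on {\<epsilon>..}"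
      using integrable_on_exp_minus_to_infinity[of 1 \<epsilon>]
      by (intro nonnegative_absolutely_integrable_1) auto
    moreover have "set_integrable lebesgue {\<epsilon>..} H"
      by (rule set_integrable_subset[OF int]) (use \<epsilon> in auto)
    ultimately show "set_integrable lebesgue {\<epsilon>..}
        (\<lambda>t. (\<bar>H 0\<bar> / \<epsilon>) * exp (- t) + 1 / (1 - exp (- \<epsilon>)) * \<bar>H t\<bar>)"
      by (intro set_integral_add set_integrable_mult_right set_integrable_abs) auto
    show "set_borel_measurable lebesgue {\<epsilon>..} ?f"
      by (rule set_borel_measurable_subset[OF meas]) (use \<epsilon> in auto)
    show "AE t in lebesgue. t \<in> {\<epsilon>..} \<longrightarrow> norm (?f t) \<le>
        norm ((\<bar>H 0\<bar> / \<epsilon>) * exp (- t) + 1 / (1 - exp (- \<epsilon>)) * \<bar>H t\<bar>)"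
    proof (intro AE_I2 impI)
      fix t :: real assume "t \<in> {\<epsilon>..}"
      then have t: "\<epsilon> \<le> t" by auto
      have "\<bar>H 0\<bar> * (exp (- t) / t) \<le> \<bar>H 0\<bar> * (exp (- t) / \<epsilon>)"
        using \<epsilon> t by (intro mult_left_mono divide_left_mono) auto
      then have 1: "\<bar>H 0 * (exp (- t) / t)\<bar> \<le> \<bar>H 0\<bar> / \<epsilon> * exp (- t)"
        using \<epsilon> t by (simp add: abs_mult)
      \<comment> \<open>The numerator is at most 1 since \<open>r \<ge> 0\<close>, and the
        denominator increases with \<open>t\<close>.\<close>
      have "exp (- r * t) / (1 - exp (- t)) \<le> 1 / (1 - exp (- \<epsilon>))"
        using \<epsilon> t r by (intro frac_le) auto
      then have "\<bar>H t\<bar> * (exp (- r * t) / (1 - exp (- t))) \<le> \<bar>H t\<bar> * (1 / (1 - exp (- \<epsilon>)))"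
        by (intro mult_left_mono) auto
      then have 2: "\<bar>H t * (exp (- r * t) / (1 - exp (- t)))\<bar> \<le> 1 / (1 - exp (- \<epsilon>)) * \<bar>H t\<bar>"
        using \<epsilon> t by (simp add: abs_mult)
      from 1 2 show "norm (?f t) \<le> norm ((\<bar>H 0\<bar> / \<epsilon>) * exp (- t) + 1 / (1 - exp (- \<epsilon>)) * \<bar>H t\<bar>)"
        unfolding real_norm_def by linarith
    qed
  qed
  have "{0<..} = {0<..<\<epsilon>} \<union> {\<epsilon>..}" using \<epsilon> by auto
  then show ?thesis using set_integrable_Un[OF near far] by simp
qed

theorem proposition2p2:
  fixes H :: "real \<Rightarrow> real" and n :: nat
  assumes "set_integrable lebesgue {0..} H"
    and "\<exists>\<epsilon>>0. bounded ((\<lambda>t. (H t - H 0) / t) ` {0<..<\<epsilon>})"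
    and "\<And>t. t \<ge> 0 \<Longrightarrow> H t \<ge> 0"
    and "\<not> (AE t in lebesgue. t \<in> {0<..} \<longrightarrow> H t = 0)"
  shows "negative_definite_on n {x. H 0 * (\<Sum>i\<le>n. x i) = 0} (q_form H n)"
  unfolding negative_definite_on_def
proof (intro ballI impI)
  fix x :: "nat \<Rightarrow> real"
  assume "x \<in> {x. H 0 * (\<Sum>i\<le>n. x i) = 0}" and nz: "\<exists>i\<le>n. x i \<noteq> 0"
  then have H0: "H 0 * (\<Sum>i\<le>n. x i) = 0" by simp
  define d where "d = (\<lambda>i j. nat \<bar>int i - int j\<bar>)"
  define f where "f = (\<lambda>k t. H 0 * (exp (- t) / t) - H t * (exp (- real k * t) / (1 - exp (- t))))"
  define S where "S = (\<lambda>t. \<Sum>i\<le>n. \<Sum>j\<le>n. x i * x j * exp (- t) ^ d i j)"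
  define g where "g = (\<lambda>t. indicator {0<..} t * (H t * S t / (1 - exp (- t))))"
  have f_int: "integrable lebesgue (\<lambda>t. indicator {0<..} t *\<^sub>R f k t)" for k
    using set_integrable_psi_integrand[OF assms(1,2), of "real k"]
    by (simp add: f_def set_integrable_def)
  have psi: "Re (psi H (of_int \<bar>int i - int j\<bar>)) = (LINT t|lebesgue. indicator {0<..} t *\<^sub>R f (d i j) t)"
    for i j
  proof -
    \<comment> \<open>With the argument recast as a real number, \<open>psi_of_real\<close> turns
      the complex integral into a real one.\<close>
    have "(of_int \<bar>int i - int j\<bar> :: complex) = complex_of_real (real (d i j))"
      unfolding d_def of_real_of_nat_eq by (rule of_nat_nat[symmetric]) simp
    then show ?thesis
      by (simp only: psi_of_real Re_complex_of_real f_def set_lebesgue_integral_def)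
  qed
  have sum_f: "(\<Sum>i\<le>n. \<Sum>j\<le>n. x i * x j * (indicator {0<..} t *\<^sub>R f (d i j) t)) = - g t" for t
  proof -
    have "(\<Sum>i\<le>n. \<Sum>j\<le>n. x i * x j * f (d i j) t) =
        (\<Sum>i\<le>n. \<Sum>j\<le>n. H 0 * (exp (- t) / t) * (x i * x j)
          - H t / (1 - exp (- t)) * (x i * x j * exp (- t) ^ d i j))"
      by (simp add: f_def algebra_simps flip: exp_of_nat_mult)
    also have "\<dots> = H 0 * (exp (- t) / t) * (\<Sum>i\<le>n. \<Sum>j\<le>n. x i * x j) - H t / (1 - exp (- t)) * S t"
      by (simp add: S_def sum_subtractf sum_distrib_left)
    also have "(\<Sum>i\<le>n. \<Sum>j\<le>n. x i * x j) = (\<Sum>i\<le>n. x i) * (\<Sum>i\<le>n. x i)"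
      by (simp add: sum_product)
    \<comment> \<open>Here the constraint enters: the singular terms add up to a multiple of
      \<open>H 0\<close> times the square of the sum of the entries.\<close>
    also have "H 0 * (exp (- t) / t) * ((\<Sum>i\<le>n. x i) * (\<Sum>i\<le>n. x i)) = 0"
      using H0 by auto
    finally have "(\<Sum>i\<le>n. \<Sum>j\<le>n. x i * x j * f (d i j) t) = - (H t * S t / (1 - exp (- t)))"
      by simp
    then show ?thesis by (simp add: g_def indicator_def)
  qed
  have int_sum: "integrable lebesgue (\<lambda>t. \<Sum>i\<le>n. \<Sum>j\<le>n. x i * x j * (indicator {0<..} t *\<^sub>R f (d i j) t))"
    by (intro Bochner_Integration.integrable_sum integrable_mult_right f_int)
  then have g_int: "integrable lebesgue g"
    unfolding sum_f by simp
  have "q_form H n x = (\<Sum>i\<le>n. \<Sum>j\<le>n. LINT t|lebesgue. x i * x j * (indicator {0<..} t *\<^sub>R f (d i j) t))"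
    by (simp add: q_form_def psi)
  also have "\<dots> = (LINT t|lebesgue. (\<Sum>i\<le>n. \<Sum>j\<le>n. x i * x j * (indicator {0<..} t *\<^sub>R f (d i j) t)))"
    by (simp only: Bochner_Integration.integral_sum Bochner_Integration.integrable_sum
        integrable_mult_right f_int)
  finally have q: "q_form H n x = - (LINT t|lebesgue. g t)"
    unfolding sum_f by simp
  have S: "S t > 0" if "t > 0" for t
    unfolding S_def d_def using that nz by (intro power_absdiff_form_pos) auto
  have g_nonneg: "g t \<ge> 0" for t
    using S[of t] assms(3)[of t] by (auto simp: g_def indicator_def)
  have g_zero: "g t = 0 \<longleftrightarrow> (t \<in> {0<..} \<longrightarrow> H t = 0)" for t
    using S[of t] by (auto simp: g_def indicator_def)
  \<comment> \<open>A nonnegative integrable function with zero integral vanishes almost everywhere.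
    As \<open>S\<close> is positive on the half-line, \<open>g\<close> vanishes there exactly where
    \<open>H\<close> does, which would make \<open>H\<close> zero almost everywhere on it.\<close>
  have "(LINT t|lebesgue. g t) \<noteq> 0"
    using integral_nonneg_eq_0_iff_AE[OF g_int] g_nonneg assms(4) by (simp add: g_zero)
  moreover have "(LINT t|lebesgue. g t) \<ge> 0"
    using g_nonneg by simp
  ultimately show "q_form H n x < 0" unfolding q by simp
qed

end
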